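(* Let $r \in \mathbb{Q}_{>0}$ with $r<1$, let $S = \{s_0 = 0 < s_1 < s_2 < \cdots\} \subseteq \mathbb{N}_0$ be infinite, let $\delta_n = s_{n+1}-s_n$ for $n \in \mathbb{N}_0$, and let $M_{r,S} = \langle r^{s_n} \mid n \in \mathbb{N}_0 \rangle$ be the additive submonoid of $\mathbb{Q}_{\geq 0}$ generated by the powers $r^{s_n}$. Suppose that $M_{r,S}$ is atomic. If there exists $m\in\mathbb{N}_0$ such that $\mathsf{d}(r)^{\delta_n} < \mathsf{n}(r)^{\delta_{n+1}}$ for all $n \geq m$, then $M_{r,S}$ satisfies the ACCP.
   Context: For $r \in \mathbb{Q}_{>0}$ write $r = \mathsf{n}(r)/\mathsf{d}(r)$ with $\mathsf{n}(r), \mathsf{d}(r)$ relatively prime positive integers. For an additive commutative, cancellative, reduced monoid $M$: an atom is a nonzero $a \in M$ such that $a=x+y$ with $x,y\in M$ implies $x=0$ or $y=0$; $M$ is atomic if it is generated by its atoms; a principal ideal is a set $x+M$ with $x \in M$; and $M$ satisfies the ACCP if every increasing sequence of principal ideals of $M$ eventually stabilizes. *)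

theory Defs
  imports Complex_Main "HOL-Library.Infinite_Set"
begin

text \<open>Additive monoids are given as subsets of an ambient type of class
  \<^class>\<open>comm_monoid_add\<close>; below the ambient type is \<^typ>\<open>rat\<close>, so that they are
  cancellative.\<close>

inductive_set submonoid_gen :: "'a::comm_monoid_add set \<Rightarrow> 'a set" for A :: "'a set" where
  zero: "0 \<in> submonoid_gen A"
| gen: "a \<in> A \<Longrightarrow> a \<in> submonoid_gen A"
| add: "x \<in> submonoid_gen A \<Longrightarrow> y \<in> submonoid_gen A \<Longrightarrow> x + y \<in> submonoid_gen A"

definition atoms :: "'a::comm_monoid_add set \<Rightarrow> 'a set" where
  "atoms M = {a \<in> M. a \<noteq> 0 \<and> (\<forall>x\<in>M. \<forall>y\<in>M. a = x + y \<longrightarrow> x = 0 \<or> y = 0)}"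

definition atomic :: "'a::comm_monoid_add set \<Rightarrow> bool" where
  "atomic M \<longleftrightarrow> M = submonoid_gen (atoms M)"

definition principal_ideal :: "'a::comm_monoid_add set \<Rightarrow> 'a \<Rightarrow> 'a set" where
  "principal_ideal M x = {x + y | y. y \<in> M}"

definition ACCP :: "'a::comm_monoid_add set \<Rightarrow> bool" where
  "ACCP M \<longleftrightarrow> (\<forall>I :: nat \<Rightarrow> 'a set.
     (\<forall>n. \<exists>x\<in>M. I n = principal_ideal M x) \<and> incseq I \<longrightarrow> (\<exists>N. \<forall>n\<ge>N. I n = I N))"

text \<open>\<^const>\<open>quotient_of\<close> returns the reduced fraction with positive denominator, so for
  positive \<open>r\<close> the conversions to \<^typ>\<open>nat\<close> lose nothing.\<close>

definition numer :: "rat \<Rightarrow> nat" where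
  "numer r = nat (fst (quotient_of r))"

definition denom :: "rat \<Rightarrow> nat" where
  "denom r = nat (snd (quotient_of r))"

lemma numer_denom:
  assumes "r > 0"
  shows "r = of_nat (numer r) / of_nat (denom r)" "coprime (numer r) (denom r)"
    "numer r > 0" "denom r > 0"
proof -
  obtain p q where pq: "quotient_of r = (p, q)"
    by (cases "quotient_of r")
  have q: "q > 0" and cop: "coprime p q" and r: "r = of_int p / of_int q"
    using quotient_of_denom_pos[OF pq] quotient_of_coprime[OF pq] quotient_of_div[OF pq]
    by auto
  have p: "p > 0"
    using assms q unfolding r by (simp add: zero_less_divide_iff)
  show "r = of_nat (numer r) / of_nat (denom r)" "numer r > 0" "denom r > 0"
    using p q r pq by (simp_all add: numer_def denom_def)
  show "coprime (numer r) (denom r)"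
    using p q cop pq by (simp add: numer_def denom_def coprime_int_iff [symmetric])
qed

definition M_rS :: "rat \<Rightarrow> nat set \<Rightarrow> rat set" where
  "M_rS r S = submonoid_gen {r ^ enumerate S n | n. True}"

text \<open>For infinite \<open>S\<close>, \<^const>\<open>enumerate\<close> is strictly increasing, so the subtraction
  on \<^typ>\<open>nat\<close> does not truncate.\<close>

definition gap :: "nat set \<Rightarrow> nat \<Rightarrow> nat" where
  "gap S n = enumerate S (Suc n) - enumerate S n"

end

theory Submission imports Defs begin

text \<open>Write \<open>r = p / q\<close> in lowest terms, let \<open>x = (\<Sum>i\<le>N. e i * r ^ s i)\<close>, and choose \<open>K \<ge> m\<close>
  such that \<open>q ^ s K\<close> clears the denominator of \<open>x\<close>. For \<open>j \<ge> K\<close> the tail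
  \<open>T j = (\<Sum>i\<in>{j<..N}. e i * r ^ s i)\<close> then has a denominator dividing \<open>q ^ s j\<close> and a numerator
  divisible by \<open>p ^ s (Suc j)\<close>, so it is an integer multiple of \<open>u j = p ^ s (Suc j) / q ^ s j\<close>.
  The hypothesis on the gaps says that \<open>u\<close> is strictly increasing, whereas \<open>T\<close> is decreasing.
  Hence the integers \<open>T j / u j\<close> strictly decrease while they are positive, so that \<open>e i > 0\<close>
  forces \<open>x \<ge> T K \<ge> (i - K) * u K\<close>. This bounds \<open>i\<close> in terms of \<open>x\<close>, so the nonzero summands
  of \<open>x\<close> in the monoid are bounded away from \<open>0\<close>, and chains of divisors of \<open>x\<close> are finite.\<close>

lemma submonoid_gen_sum:
  assumes "\<And>i. i \<in> A \<Longrightarrow> f i \<in> submonoid_gen G"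
  shows "sum f A \<in> submonoid_gen G"
  using assms by (induction A rule: infinite_finite_induct) (auto intro: submonoid_gen.intros)

text \<open>Allowing every upper limit \<open>M \<ge> N\<close> lets the representations of two
  elements be truncated at a common index and added coefficientwise.\<close>

lemma submonoid_gen_range_imp_sum:
  fixes g :: "nat \<Rightarrow> 'a::comm_semiring_1"
  assumes "x \<in> submonoid_gen (range g)"
  shows "\<exists>c N. \<forall>M\<ge>N. x = (\<Sum>i\<le>M. of_nat (c i) * g i)"
  using assms
proof induction
  case zero
  show ?case by (rule exI[of _ "\<lambda>_. 0"]) simp
next
  case (gen a)
  then obtain k where k: "a = g k" by blast
  have "a = (\<Sum>i\<le>M. of_nat (if i = k then 1 else 0) * g i)" if "M \<ge> k" for M
  proof -
    have "(\<Sum>i\<le>M. of_nat (if i = k then 1 else 0) * g i) = (\<Sum>i\<le>M. if i = k then g i else 0)"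
      by (rule sum.cong) auto
    then show ?thesis using that k by simp
  qed
  then show ?case
    by (intro exI[of _ "\<lambda>i. if i = k then 1 else 0"] exI[of _ k]) auto
next
  case (add x y)
  then obtain c N d N' where
    c: "\<forall>M\<ge>N. x = (\<Sum>i\<le>M. of_nat (c i) * g i)" and
    d: "\<forall>M\<ge>N'. y = (\<Sum>i\<le>M. of_nat (d i) * g i)" by blast
  have "x + y = (\<Sum>i\<le>M. of_nat (c i + d i) * g i)" if "M \<ge> max N N'" for M
  proof -
    have "x = (\<Sum>i\<le>M. of_nat (c i) * g i)" "y = (\<Sum>i\<le>M. of_nat (d i) * g i)"
      using c d that by auto
    then show ?thesis by (simp add: sum.distrib algebra_simps)
  qed
  then show ?case using c d
    by (intro exI[of _ "\<lambda>i. c i + d i"] exI[of _ "max N N'"]) auto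
qed

text \<open>Generators of consecutive ideals in a chain differ by elements \<open>y n\<close> of
  \<open>M\<close>, all of which are summands of the first generator \<open>x 0\<close>. A single
  \<open>e\<close> thus bounds all nonzero \<open>y n\<close> from below, while their sum is at most
  \<open>x 0\<close>, so only finitely many are nonzero.\<close>

lemma ACCP_if_summands_bounded_below:
  fixes G :: "'a::archimedean_field set"
  defines "M \<equiv> submonoid_gen G"
  assumes nonneg: "\<And>x. x \<in> M \<Longrightarrow> x \<ge> 0"
    and bound: "\<And>x. x \<in> M \<Longrightarrow> \<exists>e>0. \<forall>y\<in>M. \<forall>z\<in>M. x = y + z \<longrightarrow> y \<noteq> 0 \<longrightarrow> e \<le> y"
  shows "ACCP M"
  unfolding ACCP_def
proof (intro allI impI)
  fix I :: "nat \<Rightarrow> 'a set"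
  assume "(\<forall>n. \<exists>x\<in>M. I n = principal_ideal M x) \<and> incseq I"
  then have inc: "incseq I" and "\<forall>n. \<exists>x. x \<in> M \<and> I n = principal_ideal M x" by auto
  then obtain x where x: "\<And>n. x n \<in> M" "\<And>n. I n = principal_ideal M (x n)" by metis
  define y where "y n = x n - x (Suc n)" for n
  have y: "y n \<in> M" for n
  proof -
    have "x n \<in> I n" unfolding x principal_ideal_def M_def
      by (auto intro!: exI[of _ 0] submonoid_gen.zero)
    then have "x n \<in> I (Suc n)" using inc by (auto simp: incseq_Suc_iff)
    then show ?thesis unfolding x principal_ideal_def y_def by auto
  qed
  have tele: "x 0 = x n + (\<Sum>i<n. y i)" for n
    by (induction n) (auto simp: y_def)
  obtain e where e: "e > 0" "\<And>v w. v \<in> M \<Longrightarrow> w \<in> M \<Longrightarrow> x 0 = v + w \<Longrightarrow> v \<noteq> 0 \<Longrightarrow> e \<le> v"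
    using bound[OF x(1)[of 0]] by metis
  have ge: "e \<le> y n" if "y n \<noteq> 0" for n
  proof (rule e(2)[OF y _ _ that])
    show "x (Suc n) + (\<Sum>i<n. y i) \<in> M"
      using x(1) y unfolding M_def by (intro submonoid_gen.add submonoid_gen_sum) auto
    show "x 0 = y n + (x (Suc n) + (\<Sum>i<n. y i))"
      using tele[of "Suc n"] by (simp add: algebra_simps)
  qed
  have "finite {n. y n \<noteq> 0}"
  proof (rule ccontr)
    assume inf: "infinite {n. y n \<noteq> 0}"
    obtain k :: nat where k: "x 0 < of_nat k * e"
      using ex_less_of_nat_mult[OF e(1)] by blast
    obtain F where F: "finite F" "card F = k" "F \<subseteq> {n. y n \<noteq> 0}"
      using infinite_arbitrarily_large[OF inf] by blast
    obtain n where n: "F \<subseteq> {..<n}" using finite_nat_iff_bounded F(1) by blast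
    have "of_nat k * e = (\<Sum>i\<in>F. e)" using F by simp
    also have "\<dots> \<le> (\<Sum>i\<in>F. y i)" using F ge by (intro sum_mono) auto
    also have "\<dots> \<le> (\<Sum>i<n. y i)" using n nonneg y by (intro sum_mono2) auto
    also have "\<dots> \<le> x 0" using tele[of n] nonneg[OF x(1)[of n]] by simp
    finally show False using k by simp
  qed
  then obtain N where N: "{n. y n \<noteq> 0} \<subseteq> {..<N}" using finite_nat_iff_bounded by blast
  have "x n = x N" if "n \<ge> N" for n
    using that
  proof (induction n rule: dec_induct)
    case (step n)
    then have "y n = 0" using N by auto
    then show ?case using step by (simp add: y_def)
  qed auto
  then show "\<exists>N. \<forall>n\<ge>N. I n = I N" using x by metis
qed

text \<open>Comparing the two integrality conditions shows that \<open>a ^ k\<close> divides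
  \<open>y * b ^ n * b ^ l\<close>, and \<open>a ^ k\<close> is coprime to \<open>b ^ l\<close>. A
  divisor \<open>a ^ k\<close> found with a generous power of \<open>b\<close> thus survives with a
  smaller power that still clears the denominator.\<close>

lemma Ints_div_coprime:
  fixes y :: "'a::field_char_0"
  assumes cop: "coprime a b" and "a > 0" and "b > (0::nat)"
    and "y * of_nat b ^ n \<in> \<int>" and "y * of_nat b ^ l / of_nat a ^ k \<in> \<int>"
  shows "y * of_nat b ^ n / of_nat a ^ k \<in> \<int>"
proof -
  obtain c d where c: "y * of_nat b ^ n = of_int c" and d: "y * of_nat b ^ l / of_nat a ^ k = of_int d"
    using assms(4,5) by (auto elim!: Ints_cases)
  have d': "y * of_nat b ^ l = of_int d * of_nat a ^ k"
    using d assms(2) by (simp add: field_simps)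
  have "of_int (c * int b ^ l) = (of_int (int a ^ k * (d * int b ^ n)) :: 'a)"
    using c[symmetric] d' by (simp add: algebra_simps)
  then have "c * int b ^ l = int a ^ k * (d * int b ^ n)" by (simp only: of_int_eq_iff)
  then have "int a ^ k dvd c * int b ^ l" by simp
  moreover have "coprime (int a ^ k) (int b ^ l)" using cop by simp
  ultimately have "int a ^ k dvd c" by (simp add: coprime_dvd_mult_left_iff)
  then obtain t where "c = int a ^ k * t" by blast
  then show ?thesis using assms(2) by (simp add: c)
qed

lemma power_fraction_mult_Ints:
  assumes "(b::nat) > 0" and "i \<le> j"
  shows "(of_nat a / of_nat b) ^ i * of_nat b ^ j \<in> (\<int> :: 'a::field_char_0 set)"
proof -
  have "(of_nat a / of_nat b) ^ i * of_nat b ^ j = (of_nat a ^ i * of_nat b ^ (j - i) :: 'a)"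
    using assms by (simp add: power_divide power_diff)
  then show ?thesis by simp
qed

lemma power_fraction_div_Ints:
  assumes "(a::nat) > 0" "(b::nat) > 0" and "i \<le> j" and "k \<le> i"
  shows "(of_nat a / of_nat b) ^ i * of_nat b ^ j / of_nat a ^ k \<in> (\<int> :: 'a::field_char_0 set)"
proof -
  have "(of_nat a / of_nat b) ^ i * of_nat b ^ j / of_nat a ^ k
      = (of_nat a ^ (i - k) * of_nat b ^ (j - i) :: 'a)"
    using assms by (simp add: power_divide power_diff)
  then show ?thesis by simp
qed

context
  fixes p q :: nat and s :: "nat \<Rightarrow> nat" and m :: nat and r :: rat
  assumes pq: "coprime p q" "p > 0" "p < q"
    and s: "strict_mono s"
    and growth: "\<And>n. n \<ge> m \<Longrightarrow> q ^ (s (Suc n) - s n) < p ^ (s (Suc (Suc n)) - s (Suc n))"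
  defines "r \<equiv> of_nat p / of_nat q"
begin

text \<open>The quotient of the right side by the left is
  \<open>p ^ (s (n+2) - s (n+1)) / q ^ (s (n+1) - s n)\<close>, so this is the gap condition at
  \<open>n\<close>.\<close>

lemma tail_unit_less:
  assumes "n \<ge> m"
  shows "(of_nat p ^ s (Suc n) / of_nat q ^ s n :: rat)
    < of_nat p ^ s (Suc (Suc n)) / of_nat q ^ s (Suc n)"
proof -
  have le: "s n \<le> s (Suc n)" "s (Suc n) \<le> s (Suc (Suc n))"
    using s by (simp_all add: strict_mono_less_eq)
  have "of_nat q ^ (s (Suc n) - s n) < (of_nat p ^ (s (Suc (Suc n)) - s (Suc n)) :: rat)"
    using growth[OF assms] by (metis of_nat_less_iff of_nat_power)
  then show ?thesis using le pq by (simp add: power_diff field_simps)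
qed

text \<open>\<open>K\<close> only has to clear the denominator of \<open>x\<close>; it does not
  depend on the representation \<open>e\<close>. One \<open>K\<close> therefore serves all
  representations of \<open>x\<close>.\<close>

lemma index_bound:
  fixes e :: "nat \<Rightarrow> nat"
  defines "T \<equiv> \<lambda>j N. \<Sum>i\<in>{j<..N}. of_nat (e i) * r ^ s i"
    and "u \<equiv> \<lambda>j. of_nat p ^ s (Suc j) / of_nat q ^ s j"
  assumes x: "x = (\<Sum>i\<le>N. of_nat (e i) * r ^ s i)" "x * of_nat q ^ s K \<in> \<int>"
    and i: "i \<le> N" "e i > 0" and K: "K \<ge> m" "K \<le> i"
  shows "of_nat (i - K) * u K \<le> x"
proof -
  have q: "q > 0" and r: "r > 0" using pq by (auto simp: r_def)
  have u_pos: "u j > 0" for j using pq by (simp add: u_def)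
  have mult: "T j N / u j \<in> \<int>" if j: "K \<le> j" "j < i" for j
  proof -
    have split: "x = (\<Sum>i\<le>j. of_nat (e i) * r ^ s i) + T j N"
    proof -
      have "{..N} = {..j} \<union> {j<..N}" using j i by auto
      then show ?thesis unfolding x(1) T_def by (simp add: sum.union_disjoint ivl_disj_int)
    qed
    \<comment> \<open>\<open>q ^ s j\<close> clears both \<open>x\<close> and the head of the sum,
      hence also their difference \<open>T j N\<close>, although single terms of the tail may have
      larger denominators.\<close>
    have "x * of_nat q ^ s j = x * of_nat q ^ s K * of_nat q ^ (s j - s K)"
      using j s by (simp add: strict_mono_less_eq mult.assoc flip: power_add)
    also have "\<dots> \<in> \<int>" by (rule Ints_mult[OF x(2)]) simp
    finally have "x * of_nat q ^ s j \<in> \<int>" .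
    moreover have "(\<Sum>i\<le>j. of_nat (e i) * r ^ s i) * of_nat q ^ s j \<in> \<int>"
      unfolding sum_distrib_right mult.assoc r_def using s q
      by (intro Ints_sum Ints_mult power_fraction_mult_Ints) (auto simp: strict_mono_less_eq)
    moreover have "T j N * of_nat q ^ s j
        = x * of_nat q ^ s j - (\<Sum>i\<le>j. of_nat (e i) * r ^ s i) * of_nat q ^ s j"
      by (simp add: split algebra_simps)
    ultimately have 1: "T j N * of_nat q ^ s j \<in> \<int>" by simp
    \<comment> \<open>Each exponent in the tail is at least \<open>s (Suc j)\<close>, which yields
      the power of \<open>p\<close> termwise, but only after clearing with \<open>q ^ s N\<close>.
      \<open>Ints_div_coprime\<close> then replaces \<open>s N\<close> by
      \<open>s j\<close>.\<close>
    have "of_nat (e i) * (r ^ s i * of_nat q ^ s N / of_nat p ^ s (Suc j)) \<in> \<int>"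
      if "i \<in> {j<..N}" for i
      unfolding r_def using that s q pq
      by (intro Ints_mult power_fraction_div_Ints) (auto simp: strict_mono_less_eq)
    then have "T j N * of_nat q ^ s N / of_nat p ^ s (Suc j) \<in> \<int>"
      unfolding T_def sum_distrib_right sum_divide_distrib
      by (intro Ints_sum) (simp add: mult.assoc)
    from Ints_div_coprime[OF pq(1,2) q 1 this] show ?thesis
      by (simp add: u_def)
  qed
  have T_pos: "T j N > 0" if "j < i" for j
    unfolding T_def using that i r by (intro sum_pos2[of _ i]) auto
  \<comment> \<open>Downward induction from \<open>j = i\<close>, where the left side is
    \<open>0\<close>; every step down to \<open>K\<close> gains one unit.\<close>
  have "of_nat (i - j) * u j \<le> T j N" if "K \<le> j" "j \<le> i" for j
    using that(2,1)
  proof (induction j rule: inc_induct)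
    case base
    show ?case using r by (auto simp: T_def intro: sum_nonneg)
  next
    case (step j)
    have IH: "of_nat (i - Suc j) * u (Suc j) \<le> T (Suc j) N" using step by simp
    have "T (Suc j) N \<le> T j N" unfolding T_def using r by (intro sum_mono2) auto
    with IH have le: "of_nat (i - Suc j) * u (Suc j) \<le> T j N" by simp
    have uu: "u j < u (Suc j)" using tail_unit_less[of j] step K by (simp add: u_def)
    have "of_nat (i - Suc j) * u j < T j N"
    \<comment> \<open>For \<open>i = Suc j\<close> the factor \<open>i - Suc j\<close> vanishes, so
      strictness must come from the positivity of the tail instead of the growth of
      \<open>u\<close>.\<close>
    proof (cases "i = Suc j")
      case True
      then show ?thesis using T_pos[of j] by simp
    next
      case False
      then have "of_nat (i - Suc j) * u j < of_nat (i - Suc j) * u (Suc j)"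
        using uu step by simp
      then show ?thesis using le by (rule less_le_trans)
    qed
    \<comment> \<open>Integrality of \<open>T j N / u j\<close> turns this strict bound into the
      bound \<open>i - j\<close>.\<close>
    then have "of_nat (i - Suc j) < T j N / u j" using u_pos[of j] by (simp add: field_simps)
    moreover obtain t where t: "T j N / u j = of_int t"
      using mult[of j] step by (auto elim: Ints_cases)
    ultimately have "of_int (int (i - Suc j)) < (of_int t :: rat)" by simp
    then have "int (i - Suc j) < t" by (simp only: of_int_less_iff)
    then have "int (i - j) \<le> t" using step by linarith
    then have "(of_int (int (i - j)) :: rat) \<le> T j N / u j" unfolding t by (simp only: of_int_le_iff)
    then show ?case using u_pos[of j] by (simp add: field_simps)
  qed
  from this[of K] have "of_nat (i - K) * u K \<le> T K N" using K by simp
  also have "\<dots> \<le> x" unfolding x(1) T_def using r by (intro sum_mono2) auto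
  finally show ?thesis .
qed

text \<open>A nonzero summand \<open>y\<close> contains some generator \<open>r ^ s i\<close>, and
  \<open>index_bound\<close> limits \<open>i\<close> in terms of \<open>x\<close> alone. As
  \<open>r < 1\<close>, the generator of largest admissible index is a lower bound.\<close>

lemma power_monoid_summands_bounded_below:
  defines "M \<equiv> submonoid_gen (range (\<lambda>n. r ^ s n))"
  assumes "x \<in> M"
  shows "\<exists>\<epsilon>>0. \<forall>y\<in>M. \<forall>z\<in>M. x = y + z \<longrightarrow> y \<noteq> 0 \<longrightarrow> \<epsilon> \<le> y"
proof -
  have q: "q > 0" and r: "r > 0" "r \<le> 1" using pq by (auto simp: r_def)
  obtain a L where L: "\<forall>M\<ge>L. x = (\<Sum>i\<le>M. of_nat (a i) * r ^ s i)"
    using submonoid_gen_range_imp_sum[OF assms(2)[unfolded M_def]] by blast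
  define K where "K = max m L"
  have K: "K \<ge> m" by (simp add: K_def)
  have "x = (\<Sum>i\<le>K. of_nat (a i) * r ^ s i)" using L by (simp add: K_def)
  then have xK: "x * of_nat q ^ s K \<in> \<int>"
    unfolding sum_distrib_right mult.assoc r_def using s q
    by (auto simp: strict_mono_less_eq sum_distrib_right mult.assoc
        intro!: Ints_sum Ints_mult power_fraction_mult_Ints)
  define u :: rat where "u = of_nat p ^ s (Suc K) / of_nat q ^ s K"
  have u: "u > 0" using pq by (simp add: u_def)
  \<comment> \<open>An index \<open>i > K + k\<close> would force
    \<open>x \<ge> (i - K) * u \<ge> k * u\<close>, so \<open>K + k\<close> bounds all indices that
    occur.\<close>
  obtain k :: nat where k: "x < of_nat k * u" using ex_less_of_nat_mult[OF u] by blast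
  have "r ^ s (K + k) \<le> y" if y: "y \<in> M" and z: "z \<in> M" and xyz: "x = y + z" and "y \<noteq> 0" for y z
  proof -
    obtain c N where c: "\<forall>M\<ge>N. y = (\<Sum>i\<le>M. of_nat (c i) * r ^ s i)"
      using submonoid_gen_range_imp_sum[OF y[unfolded M_def]] by blast
    obtain d N' where d: "\<forall>M\<ge>N'. z = (\<Sum>i\<le>M. of_nat (d i) * r ^ s i)"
      using submonoid_gen_range_imp_sum[OF z[unfolded M_def]] by blast
    define B where "B = max N N'"
    have yB: "y = (\<Sum>i\<le>B. of_nat (c i) * r ^ s i)" and zB: "z = (\<Sum>i\<le>B. of_nat (d i) * r ^ s i)"
      using c d by (simp_all add: B_def)
    \<comment> \<open>\<open>index_bound\<close> is applied to this representation of
      \<open>x\<close>, which may differ from the one by \<open>a\<close> used to choose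
      \<open>K\<close>; \<open>c i > 0\<close> makes its coefficient at \<open>i\<close>
      positive.\<close>
    have xB: "x = (\<Sum>i\<le>B. of_nat (c i + d i) * r ^ s i)"
      by (simp add: xyz yB zB sum.distrib algebra_simps)
    obtain i where i: "i \<le> B" "c i > 0"
      using \<open>y \<noteq> 0\<close> yB by (metis (no_types, lifting) atMost_iff gr0I mult_zero_left of_nat_0 sum.neutral)
    have "i \<le> K + k"
    proof (rule ccontr)
      assume "\<not> i \<le> K + k"
      then have "of_nat (i - K) * u \<le> x"
        using index_bound[OF xB xK, of i] i K by (simp add: u_def)
      moreover have "of_nat k * u \<le> of_nat (i - K) * u"
        using \<open>\<not> i \<le> K + k\<close> u by (intro mult_right_mono) auto
      ultimately have "of_nat k * u \<le> x" by simp
      then show False using k by simp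
    qed
    then have "r ^ s (K + k) \<le> r ^ s i"
      using r s by (intro power_decreasing) (auto simp: strict_mono_less_eq)
    also have "\<dots> \<le> of_nat (c i) * r ^ s i" using i r by simp
    also have "\<dots> \<le> y" unfolding yB using i r
      by (intro member_le_sum[of i _ "\<lambda>i. of_nat (c i) * r ^ s i"]) auto
    finally show ?thesis .
  qed
  then show ?thesis using r by (intro exI[of _ "r ^ s (K + k)"]) auto
qed

lemma ACCP_power_monoid: "ACCP (submonoid_gen (range (\<lambda>n. r ^ s n)))"
proof (rule ACCP_if_summands_bounded_below)
  fix x assume "x \<in> submonoid_gen (range (\<lambda>n. r ^ s n))"
  then show "x \<ge> 0"
    by induction (auto simp: r_def)
qed (rule power_monoid_summands_bounded_below)

end

theorem proposition4p5:
  fixes r :: rat and S :: "nat set"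
  assumes "r > 0" and "r < 1"
    and "infinite S" and "0 \<in> S"
    and "atomic (M_rS r S)"
    and "\<exists>m. \<forall>n\<ge>m. denom r ^ gap S n < numer r ^ gap S (Suc n)"
  shows "ACCP (M_rS r S)"
proof -
  note nd = numer_denom[OF assms(1)]
  have "numer r < denom r"
    using assms(2) nd by (metis divide_less_eq_1_pos of_nat_0_less_iff of_nat_less_iff)
  moreover have "strict_mono (enumerate S)"
    using assms(3) by (simp add: strict_mono_enumerate)
  ultimately have "ACCP (submonoid_gen (range
      (\<lambda>n. (of_nat (numer r) / of_nat (denom r) :: rat) ^ enumerate S n)))"
    using nd assms(6) unfolding gap_def by (metis ACCP_power_monoid)
  moreover have "{r ^ enumerate S n | n. True} = range (\<lambda>n. r ^ enumerate S n)" by auto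
  ultimately show ?thesis unfolding M_rS_def using nd(1) by simp
qed

end
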